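(* For every odd $n\ge13$, every crossing optimal 2-page book drawing of $K_n$ (normalized as in the context) has exactly one Hamiltonian cycle consisting of non-crossed edges, namely the cycle $1,2,\dots,n,1$ formed by the spine edges $12,23,\dots,(n-1)n$ and the edge $1n$.
   Context: Normalized 2-page book drawings of $K_n$: vertices $(1,0),\dots,(n,0)$ labelled $1,\dots,n$ left to right; edges $i(i+1)$ drawn on the $x$-axis; edge $1n$ in the upper half-plane; every other edge $ij$ a semicircle over $[i,j]$ in the upper or lower half-plane. A drawing is crossing optimal if it has exactly $Z(n)=\frac14\lfloor\frac n2\rfloor\lfloor\frac{n-1}2\rfloor\lfloor\frac{n-2}2\rfloor\lfloor\frac{n-3}2\rfloor$ crossings. An edge is non-crossed if no other edge crosses it. *)

theory Defs
  imports Main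
begin

text \<open>A normalized 2-page book drawing of K_n on vertices 1..n is given by
  D :: nat => nat => bool, where for 1 <= i < j <= n with j ~= i+1 the value D i j
  says whether the semicircle of edge ij lies in the upper half-plane (True) or the
  lower one (False). Spine edges i(i+1) lie on the x-axis; edge 1n is upper.\<close>

definition edges :: "nat \<Rightarrow> nat set set" where
  "edges n = {{i, j} | i j. 1 \<le> i \<and> i < j \<and> j \<le> n}"

definition normalized :: "nat \<Rightarrow> (nat \<Rightarrow> nat \<Rightarrow> bool) \<Rightarrow> bool" where
  "normalized n D \<longleftrightarrow> D 1 n"

definition cross_ord :: "(nat \<Rightarrow> nat \<Rightarrow> bool) \<Rightarrow> nat set \<Rightarrow> nat set \<Rightarrow> bool" where
  "cross_ord D e f \<longleftrightarrow> (\<exists>i j k l. e = {i, j} \<and> f = {k, l} \<and> i < j \<and> k < l \<and>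
      j \<noteq> Suc i \<and> l \<noteq> Suc k \<and> D i j = D k l \<and> i < k \<and> k < j \<and> j < l)"

definition crosses :: "(nat \<Rightarrow> nat \<Rightarrow> bool) \<Rightarrow> nat set \<Rightarrow> nat set \<Rightarrow> bool" where
  "crosses D e f \<longleftrightarrow> cross_ord D e f \<or> cross_ord D f e"

definition crossing_number :: "nat \<Rightarrow> (nat \<Rightarrow> nat \<Rightarrow> bool) \<Rightarrow> nat" where
  "crossing_number n D = card {{e, f} | e f. e \<in> edges n \<and> f \<in> edges n \<and> crosses D e f}"

definition Z :: "nat \<Rightarrow> nat" where
  "Z n = ((n div 2) * ((n - 1) div 2) * ((n - 2) div 2) * ((n - 3) div 2)) div 4"

definition crossing_optimal :: "nat \<Rightarrow> (nat \<Rightarrow> nat \<Rightarrow> bool) \<Rightarrow> bool" where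
  "crossing_optimal n D \<longleftrightarrow> normalized n D \<and> crossing_number n D = Z n"

definition non_crossed :: "nat \<Rightarrow> (nat \<Rightarrow> nat \<Rightarrow> bool) \<Rightarrow> nat set \<Rightarrow> bool" where
  "non_crossed n D e \<longleftrightarrow> \<not> (\<exists>f \<in> edges n. crosses D e f)"

definition ham_cycle :: "nat \<Rightarrow> nat set set \<Rightarrow> bool" where
  "ham_cycle n C \<longleftrightarrow> (\<exists>p. distinct p \<and> set p = {1..n} \<and>
      C = {{p ! i, p ! ((i + 1) mod n)} | i. i < n})"

definition standard_cycle :: "nat \<Rightarrow> nat set set" where
  "standard_cycle n = {{i, Suc i} | i. 1 \<le> i \<and> i < n} \<union> {{1, n}}"

end

theory Submission
  imports Defs
begin

text \<open>
  Orient every triple of vertices as in the drawing; this splits the other vertices into those to the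
  left and to the right of an edge. Counting separated pairs of vertices expresses the number of
  crossings through the numbers of edges having at most \<open>k\<close> vertices on one side (k-edges). Removing
  the last vertex bounds these numbers from below, and this yields \<open>Z n\<close>. For odd \<open>n\<close> every such bound
  must be attained by an optimal drawing, and the same holds for each of its cyclic rotations.

  Equality for the third vertex of a rotated drawing is already enough: an edge that has at least two
  vertices on each side along the cycle is crossed, and two edges \<open>v (v+2)\<close> and \<open>(v+1) (v+3)\<close> are not
  both non-crossed. So a Hamiltonian cycle of non-crossed edges only uses steps of length at most 2
  along the spine cycle; if it used \<open>v (v+2)\<close>, then \<open>v+1\<close> would need another step of length 2, since
  otherwise the cycle would close up to a triangle.
\<close>

section \<open>Ranks in a two-coloured fan\<close>

text \<open>The elements satisfying \<open>f\<close> are numbered from the left, and the numbering is then continued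
  with the remaining elements from the right.\<close>

definition fan_rank :: "(nat \<Rightarrow> bool) \<Rightarrow> nat \<Rightarrow> nat \<Rightarrow> nat" where
  "fan_rank f n i = card {r. r < i \<and> f r} + (if f i then 0 else n - 1 - i)"

lemma card_less_mono_bound:
  assumes "i \<le> (j::nat)"
  shows "card {r. r < j \<and> f r} \<le> card {r. r < i \<and> f r} + card {r. i \<le> r \<and> r < j \<and> f r}"
proof -
  have "{r. r < j \<and> f r} \<subseteq> {r. r < i \<and> f r} \<union> {r. i \<le> r \<and> r < j \<and> f r}" by auto
  then have "card {r. r < j \<and> f r} \<le> card ({r. r < i \<and> f r} \<union> {r. i \<le> r \<and> r < j \<and> f r})"
    by (rule card_mono[rotated]) simp
  also have "\<dots> \<le> card {r. r < i \<and> f r} + card {r. i \<le> r \<and> r < j \<and> f r}" by (rule card_Un_le)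
  finally show ?thesis .
qed

lemma fan_rank_less:
  assumes "i < n" shows "fan_rank f n i < n"
proof -
  have "card {r. r < i \<and> f r} \<le> card {..<i}" by (rule card_mono) auto
  then show ?thesis using assms by (auto simp: fan_rank_def)
qed

text \<open>If \<open>f i\<close> holds, every later element has a larger rank than
  \<open>i\<close>. Otherwise every later element has a smaller one: the count gains at most
  \<open>j - i - 1\<close> between \<open>i\<close> and \<open>j\<close>, while the term counted
  from the right loses at least \<open>j - i\<close>.\<close>

lemma fan_rank_neq:
  assumes "i < j" "j < n" shows "fan_rank f n i \<noteq> fan_rank f n j"
proof (cases "f i")
  case True
  have "insert i {r. r < i \<and> f r} \<subseteq> {r. r < j \<and> f r}" using True assms by auto
  then have "card (insert i {r. r < i \<and> f r}) \<le> card {r. r < j \<and> f r}" by (rule card_mono[rotated]) simp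
  then show ?thesis using True by (simp add: fan_rank_def)
next
  case False
  have "card {r. i \<le> r \<and> r < j \<and> f r} \<le> card {i<..<j}"
    using False by (intro card_mono) (auto simp: le_less)
  then have "card {r. r < j \<and> f r} \<le> card {r. r < i \<and> f r} + (j - i - 1)"
    using card_less_mono_bound[of i j f] assms by simp
  then show ?thesis using False assms by (auto simp: fan_rank_def)
qed

lemma bij_betw_fan_rank: "bij_betw (fan_rank f n) {..<n} {..<n}"
proof -
  have inj: "inj_on (fan_rank f n) {..<n}"
    by (rule linorder_inj_onI) (auto dest: fan_rank_neq)
  have "fan_rank f n ` {..<n} \<subseteq> {..<n}" using fan_rank_less by auto
  then have "fan_rank f n ` {..<n} = {..<n}" by (rule endo_inj_surj[OF finite_lessThan _ inj])
  with inj show ?thesis by (simp add: bij_betw_def)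
qed

text \<open>The ranks form a permutation of \<open>{..<n}\<close>, so the colouring does not matter.
  This independence is the source of the lower bounds on \<open>invariant_row\<close>.\<close>

lemma card_fan_rank_less:
  assumes "k \<le> n" shows "card {i. i < n \<and> fan_rank f n i < k} = k"
proof -
  have "bij_betw (fan_rank f n) {i. i < n \<and> fan_rank f n i < k} {..<k}"
    using bij_betw_fan_rank[of f n] assms unfolding bij_betw_def
    by (auto intro: inj_on_subset)
  then show ?thesis using bij_betw_same_card by fastforce
qed

section \<open>Crossings and separated pairs\<close>

text \<open>Vertices are shifted to start at 0. On four sorted vertices only \<open>i j\<close> and
  \<open>k l\<close> interleave, and since \<open>k\<close> and \<open>j\<close> lie strictly inside
  these edges, spine edges are excluded automatically.\<close>

definition crossing_count :: "nat \<Rightarrow> (nat \<Rightarrow> nat \<Rightarrow> bool) \<Rightarrow> nat" where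
  "crossing_count n E = card {(i, k, j, l). i < k \<and> k < j \<and> j < l \<and> l < n \<and> E i j = E k l}"

text \<open>The triple \<open>i < j < r\<close> is oriented counterclockwise iff its longest edge \<open>i r\<close> is in the upper page.\<close>

definition left_of :: "(nat \<Rightarrow> nat \<Rightarrow> bool) \<Rightarrow> nat \<Rightarrow> nat \<Rightarrow> nat \<Rightarrow> bool" where
  "left_of E i j r = (if r < i then E r j else if r < j then \<not> E i j else E i r)"

definition side_count :: "nat \<Rightarrow> (nat \<Rightarrow> nat \<Rightarrow> bool) \<Rightarrow> nat \<Rightarrow> nat \<Rightarrow> bool \<Rightarrow> nat" where
  "side_count n E i j b = card {r. r < n \<and> r \<noteq> i \<and> r \<noteq> j \<and> left_of E i j r = b}"

definition pairs :: "nat \<Rightarrow> (nat \<times> nat) set" where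
  "pairs n = {(i, j). i < j \<and> j < n}"

definition quads :: "nat \<Rightarrow> (nat \<times> nat \<times> nat \<times> nat) set" where
  "quads n = {(i, k, j, l). i < k \<and> k < j \<and> j < l \<and> l < n}"

text \<open>An edge with \<open>k\<close> vertices on its smaller side contributes \<open>K - k\<close>, truncated at 0; this is the
  double cumulative count of the j-edges with \<open>j < K\<close>.\<close>

definition edge_weight :: "nat \<Rightarrow> (nat \<Rightarrow> nat \<Rightarrow> bool) \<Rightarrow> nat \<Rightarrow> nat" where
  "edge_weight n E K = (\<Sum>(i, j)\<in>pairs n. K - min (side_count n E i j True) (side_count n E i j False))"

lemma finite_pairs [simp]: "finite (pairs n)"
  by (rule finite_subset[of _ "{..<n} \<times> {..<n}"]) (auto simp: pairs_def)

lemma finite_quads [simp]: "finite (quads n)"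
  by (rule finite_subset[of _ "{..<n} \<times> {..<n} \<times> {..<n} \<times> {..<n}"]) (auto simp: quads_def)

section \<open>Numbers of pairs, triples and quadruples of vertices\<close>

lemma pairs_Suc: "pairs (Suc n) = pairs n \<union> (\<lambda>i. (i, n)) ` {..<n}"
  by (auto simp: pairs_def less_Suc_eq)

lemma card_pairs: "2 * card (pairs n) = n * (n - 1)"
proof (induction n)
  case (Suc n)
  have "card (pairs (Suc n)) = card (pairs n) + card ((\<lambda>i. (i, n)) ` {..<n})"
    unfolding pairs_Suc by (subst card_Un_disjoint) (simp_all add: disjoint_iff image_iff, simp add: pairs_def)
  also have "card ((\<lambda>i. (i, n)) ` {..<n}) = n" by (subst card_image) (auto simp: inj_on_def)
  finally show ?case using Suc by (cases n) (auto simp: algebra_simps)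
qed (simp add: pairs_def)

lemma card_triples: "6 * card {(i, k, j). i < k \<and> k < j \<and> j < (n::nat)} = n * (n - 1) * (n - 2)"
proof (induction n)
  case (Suc n)
  have "{(i, k, j). i < k \<and> k < j \<and> j < Suc n} =
      {(i, k, j). i < k \<and> k < j \<and> j < n} \<union> (\<lambda>(i, k). (i, k, n)) ` pairs n"
    by (auto simp: pairs_def less_Suc_eq)
  moreover have "finite {(i, k, j). i < k \<and> k < j \<and> j < n}"
    by (rule finite_subset[of _ "{..<n} \<times> {..<n} \<times> {..<n}"]) auto
  ultimately have "card {(i, k, j). i < k \<and> k < j \<and> j < Suc n} =
      card {(i, k, j). i < k \<and> k < j \<and> j < n} + card ((\<lambda>(i, k). (i, k, n)) ` pairs n)"
    by (simp, subst card_Un_disjoint) auto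
  also have "card ((\<lambda>(i, k). (i, k, n)) ` pairs n) = card (pairs n)"
    by (rule card_image) (auto simp: inj_on_def)
  finally have "6 * card {(i, k, j). i < k \<and> k < j \<and> j < Suc n} = n * (n - 1) * (n - 2) + 3 * (n * (n - 1))"
    using Suc card_pairs[of n] by simp
  also have "\<dots> = Suc n * (Suc n - 1) * (Suc n - 2)"
    by (cases n; cases "n - 1") (auto simp: algebra_simps)
  finally show ?case .
qed simp

lemma card_quads: "24 * card (quads n) = n * (n - 1) * (n - 2) * (n - 3)"
proof (induction n)
  case (Suc n)
  let ?T = "{(i, k, j). i < k \<and> k < j \<and> j < n}"
  have "quads (Suc n) = quads n \<union> (\<lambda>(i, k, j). (i, k, j, n)) ` ?T"
    by (auto simp: quads_def less_Suc_eq image_iff)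
  moreover have "finite ?T"
    by (rule finite_subset[of _ "{..<n} \<times> {..<n} \<times> {..<n}"]) auto
  ultimately have "card (quads (Suc n)) = card (quads n) + card ((\<lambda>(i, k, j). (i, k, j, n)) ` ?T)"
    by (simp, subst card_Un_disjoint) (simp_all add: disjoint_iff image_iff, auto simp: quads_def)
  also have "card ((\<lambda>(i, k, j). (i, k, j, n)) ` ?T) = card ?T"
    by (rule card_image) (auto simp: inj_on_def)
  finally have "24 * card (quads (Suc n)) = n * (n - 1) * (n - 2) * (n - 3) + 4 * (n * (n - 1) * (n - 2))"
    using Suc card_triples[of n] by simp
  also have "\<dots> = Suc n * (Suc n - 1) * (Suc n - 2) * (Suc n - 3)"
  proof -
    \<comment> \<open>From \<open>n = 3\<close> on no subtraction is truncated and the claim is a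
      polynomial identity; smaller values are checked one by one.\<close>
    have "n = 0 \<or> n = 1 \<or> n = 2 \<or> (\<exists>k. n = k + 3)" by presburger
    then show ?thesis by (elim disjE exE) (simp_all add: algebra_simps)
  qed
  finally show ?case .
next
  case 0
  have "quads 0 = {}" by (auto simp: quads_def)
  then show ?case by simp
qed

text \<open>All ways to choose an edge and an ordered pair of further vertices from four vertices.\<close>

definition splits :: "nat \<Rightarrow> nat \<Rightarrow> nat \<Rightarrow> nat \<Rightarrow> (nat \<times> nat \<times> nat \<times> nat) list" where
  "splits i k j l = [(i,k,j,l), (i,k,l,j), (i,j,k,l), (i,j,l,k), (i,l,k,j), (i,l,j,k),
     (k,j,i,l), (k,j,l,i), (k,l,i,j), (k,l,j,i), (j,l,i,k), (j,l,k,i)]"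

definition separations :: "(nat \<Rightarrow> nat \<Rightarrow> bool) \<Rightarrow> nat \<times> nat \<times> nat \<times> nat \<Rightarrow> (nat \<times> nat \<times> nat \<times> nat) set" where
  "separations E = (\<lambda>(i, k, j, l).
     set (filter (\<lambda>(x, y, r, s). left_of E x y r \<and> \<not> left_of E x y s) (splits i k j l)))"

text \<open>The edge \<open>i l\<close> never separates the other two vertices, exactly one of
  \<open>i k\<close> and \<open>i j\<close> does, and so does exactly one of \<open>k l\<close> and
  \<open>j l\<close>. The edge \<open>k j\<close> separates iff \<open>i j\<close> and
  \<open>k l\<close> are in different pages, that is, iff they do not cross. Each separating edge
  yields one tuple because the vertex on its left comes first.\<close>

lemma card_separations:
  assumes "i < k" "k < j" "j < l"
  shows "card (separations E (i, k, j, l)) = (if E i j = E k l then 2 else 3)"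
proof -
  let ?ys = "filter (\<lambda>(x, y, r, s). left_of E x y r \<and> \<not> left_of E x y s) (splits i k j l)"
  have "distinct ?ys"
    using assms by (intro distinct_filter) (simp add: splits_def)
  then have "card (separations E (i, k, j, l)) = length ?ys"
    by (simp only: separations_def distinct_card prod.case)
  also have "\<dots> = (if E i j = E k l then 2 else 3)"
    using assms by (simp add: left_of_def splits_def)
  finally show ?thesis .
qed

lemma set_eq_if_in_splits: "(x, y, r, s) \<in> set (splits i k j l) \<Longrightarrow> {i, k, j, l} = {x, y, r, s}"
  unfolding splits_def by (simp, elim disjE) auto

lemma in_splits_exists:
  assumes "x < y" "r \<noteq> x" "r \<noteq> y" "s \<noteq> x" "s \<noteq> y" "r \<noteq> s"
  shows "\<exists>i k j l. i < k \<and> k < j \<and> j < l \<and> (x, y, r, s) \<in> set (splits i k j l)"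
proof -
  have P: ?thesis if "(x, y, r, s) \<in> set (splits i k j l)" "i < k" "k < j" "j < l" for i k j l
    using that by blast
  have "r < x \<or> x < r \<and> r < y \<or> y < r" "s < x \<or> x < s \<and> s < y \<or> y < s" "r < s \<or> s < r"
    using assms by auto
  then show ?thesis
    \<comment> \<open>The twelve instances of \<open>P\<close> are the twelve relative orders of
      four vertices with \<open>x < y\<close>.\<close>
    by (elim disjE conjE)
      ((rule P[of x y r s] P[of x y s r] P[of x r y s] P[of x r s y] P[of x s y r] P[of x s r y]
        P[of r x y s] P[of r x s y] P[of r s x y] P[of s x y r] P[of s x r y] P[of s r x y];
        (assumption | rule assms(1) | simp add: splits_def))+)
qed

lemma separations_disjoint:
  assumes "t \<in> quads n" "u \<in> quads n" "t \<noteq> u"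
  shows "separations E t \<inter> separations E u = {}"
proof -
  obtain i k j l where t: "t = (i, k, j, l)" "i < k" "k < j" "j < l"
    using assms(1) by (auto simp: quads_def)
  obtain i' k' j' l' where u: "u = (i', k', j', l')" "i' < k'" "k' < j'" "j' < l'"
    using assms(2) by (auto simp: quads_def)
  have "t = u" if "(x, y, r, s) \<in> separations E t" "(x, y, r, s) \<in> separations E u" for x y r s
  proof -
    from that have "(x, y, r, s) \<in> set (splits i k j l)" "(x, y, r, s) \<in> set (splits i' k' j' l')"
      by (simp_all add: separations_def t u)
    then have "set [i, k, j, l] = set [i', k', j', l']"
      using set_eq_if_in_splits[of x y r s] by simp
    moreover have "sorted [i, k, j, l]" "sorted [i', k', j', l']" "distinct [i, k, j, l]" "distinct [i', k', j', l']"
      using t u by auto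
    ultimately have "[i, k, j, l] = [i', k', j', l']" by (metis sorted_distinct_set_unique)
    then show ?thesis by (simp add: t u)
  qed
  with assms(3) show ?thesis by auto
qed

lemma Union_separations:
  "(\<Union>t\<in>quads n. separations E t) = {(x, y, r, s). x < y \<and> y < n \<and> r < n \<and> r \<noteq> x \<and> r \<noteq> y \<and>
     s < n \<and> s \<noteq> x \<and> s \<noteq> y \<and> left_of E x y r \<and> \<not> left_of E x y s}" (is "?U = ?S")
proof (intro equalityI subsetI)
  fix t assume "t \<in> ?S"
  then obtain x y r s where t: "t = (x, y, r, s)" and *: "x < y" "y < n" "r < n" "r \<noteq> x" "r \<noteq> y"
      "s < n" "s \<noteq> x" "s \<noteq> y" "left_of E x y r" "\<not> left_of E x y s"
    by auto
  then have "r \<noteq> s" by auto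
  obtain i k j l where q: "i < k" "k < j" "j < l" and sp: "(x, y, r, s) \<in> set (splits i k j l)"
    using in_splits_exists[of x y r s] * \<open>r \<noteq> s\<close> by auto
  have "l \<in> {x, y, r, s}" using set_eq_if_in_splits[OF sp] by blast
  then have "l < n" using * by auto
  then show "t \<in> ?U"
    using q sp * by (intro UN_I[of "(i, k, j, l)"]) (simp_all add: separations_def quads_def t)
next
  fix t assume "t \<in> ?U"
  then obtain i k j l x y r s where "i < k" "k < j" "j < l" "l < n" and t: "t = (x, y, r, s)"
    and "(x, y, r, s) \<in> set (splits i k j l)" "left_of E x y r" "\<not> left_of E x y s"
    by (auto simp: quads_def separations_def)
  then show "t \<in> ?S" unfolding splits_def t by (simp, elim disjE) auto
qed

text \<open>Double counting of edges together with one vertex on each side. Grouped by edge this is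
  the sum of products; grouped by the four vertices involved it is 2 or 3 per quadruple, and adding
  1 for a crossing always makes 3.\<close>

lemma sum_side_count_mult:
  "(\<Sum>(i, j)\<in>pairs n. side_count n E i j True * side_count n E i j False) + crossing_count n E = 3 * card (quads n)"
proof -
  define S where "S = (\<Union>t\<in>quads n. separations E t)"
  let ?A = "\<lambda>(i, j). {r. r < n \<and> r \<noteq> i \<and> r \<noteq> j \<and> left_of E i j r = True} \<times>
      {r. r < n \<and> r \<noteq> i \<and> r \<noteq> j \<and> left_of E i j r = False}"
  have "S = (\<lambda>((x, y), (r, s)). (x, y, r, s)) ` Sigma (pairs n) ?A"
    unfolding S_def Union_separations by (auto simp: pairs_def image_iff)
  then have "card S = card (Sigma (pairs n) ?A)"
    by (simp only:) (rule card_image, auto simp: inj_on_def)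
  also have "\<dots> = (\<Sum>p\<in>pairs n. card (?A p))" by (rule card_SigmaI) auto
  also have "\<dots> = (\<Sum>(i, j)\<in>pairs n. side_count n E i j True * side_count n E i j False)"
    by (rule sum.cong) (auto simp: side_count_def card_cartesian_product)
  finally have 1: "card S = (\<Sum>(i, j)\<in>pairs n. side_count n E i j True * side_count n E i j False)" .
  have "finite (separations E t)" for t by (cases t) (simp add: separations_def)
  then have "card S = (\<Sum>t\<in>quads n. card (separations E t))"
    unfolding S_def by (intro card_UN_disjoint) (auto simp: separations_disjoint)
  moreover have "crossing_count n E = (\<Sum>t\<in>quads n. case t of (i, k, j, l) \<Rightarrow> of_bool (E i j = E k l))"
  proof -
    have "crossing_count n E = card (quads n \<inter> {t. case t of (i, k, j, l) \<Rightarrow> E i j = E k l})"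
      unfolding crossing_count_def by (rule arg_cong[of _ _ card]) (auto simp: quads_def)
    also have "\<dots> = (\<Sum>t\<in>quads n. of_bool (case t of (i, k, j, l) \<Rightarrow> E i j = E k l))"
      by simp
    finally show ?thesis by (simp add: case_prod_unfold)
  qed
  ultimately have "card S + crossing_count n E =
      (\<Sum>t\<in>quads n. card (separations E t) + (case t of (i, k, j, l) \<Rightarrow> of_bool (E i j = E k l)))"
    by (simp add: sum.distrib)
  also have "\<dots> = (\<Sum>t\<in>quads n. 3)"
  proof (rule sum.cong)
    fix t assume "t \<in> quads n"
    then obtain i k j l where t: "t = (i, k, j, l)" "i < k" "k < j" "j < l" by (auto simp: quads_def)
    then show "card (separations E t) + (case t of (i, k, j, l) \<Rightarrow> of_bool (E i j = E k l)) = 3"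
      using card_separations[OF t(2-4), of E] by simp
  qed simp
  finally show ?thesis using 1 by simp
qed

section \<open>Lower bounds for the edge weights\<close>

lemma side_count_add:
  assumes "i < j" "j < n"
  shows "side_count n E i j True + side_count n E i j False = n - 2"
proof -
  have "{r. r < n \<and> r \<noteq> i \<and> r \<noteq> j \<and> left_of E i j r = True} \<union>
      {r. r < n \<and> r \<noteq> i \<and> r \<noteq> j \<and> left_of E i j r = False} = {..<n} - {i, j}" by auto
  moreover have "card ({..<n} - {i, j}) = n - 2" using assms by (subst card_Diff_subset) auto
  ultimately show ?thesis unfolding side_count_def by (subst card_Un_disjoint[symmetric]) auto
qed

lemma side_count_Suc:
  assumes "i < j" "j < n"
  shows "side_count (Suc n) E i j b = side_count n E i j b + of_bool (E i n = b)"
proof -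
  have "{r. r < Suc n \<and> r \<noteq> i \<and> r \<noteq> j \<and> left_of E i j r = b} =
      {r. r < n \<and> r \<noteq> i \<and> r \<noteq> j \<and> left_of E i j r = b} \<union> (if E i n = b then {n} else {})"
    using assms by (auto simp: left_of_def less_Suc_eq split: if_splits)
  then show ?thesis unfolding side_count_def by auto
qed

text \<open>As \<open>left_of\<close> is an orientation, the left side of \<open>i n\<close> is a
  rank of \<open>i\<close> in the fan of edges at \<open>n\<close>. Hence the edges at the last
  vertex realise every left count below \<open>n\<close> exactly once.\<close>

lemma side_count_last:
  assumes "i < n"
  shows "side_count (Suc n) E i n True = fan_rank (\<lambda>r. E r n) n i"
proof -
  have "{r. r < Suc n \<and> r \<noteq> i \<and> r \<noteq> n \<and> left_of E i n r = True} =
      {r. r < i \<and> E r n} \<union> (if E i n then {} else {i<..<n})"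
    using assms by (auto simp: left_of_def less_Suc_eq split: if_splits)
  moreover have "card ({r. r < i \<and> E r n} \<union> {i<..<n}) = card {r. r < i \<and> E r n} + card {i<..<n}"
    by (rule card_Un_disjoint) auto
  ultimately show ?thesis unfolding side_count_def fan_rank_def by simp
qed

text \<open>Since \<open>left_of E i j n\<close> equals \<open>E i n\<close>, the value
  \<open>b\<close> names the side of \<open>i j\<close> that avoids \<open>n\<close>. The last two
  summands together are a fan rank in the row of \<open>i\<close> read from the right.\<close>

lemma side_count_row:
  assumes "i < j" "j < n" "b = (\<not> E i n)"
  shows "side_count (Suc n) E i j b =
    card {r. r < i \<and> E r j = b} + (if E i j = b then 0 else j - i - 1) + card {r. j < r \<and> r < n \<and> E i r = b}"
proof -
  have eq: "{r. r < Suc n \<and> r \<noteq> i \<and> r \<noteq> j \<and> left_of E i j r = b} =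
      ({r. r < i \<and> E r j = b} \<union> (if E i j = b then {} else {i<..<j})) \<union> {r. j < r \<and> r < n \<and> E i r = b}"
    using assms by (auto simp: left_of_def less_Suc_eq split: if_splits)
  have "card ({r. r < i \<and> E r j = b} \<union> (if E i j = b then {} else {i<..<j})) =
      card {r. r < i \<and> E r j = b} + card (if E i j = b then {} else {i<..<j})"
    by (rule card_Un_disjoint) auto
  moreover have "card (({r. r < i \<and> E r j = b} \<union> (if E i j = b then {} else {i<..<j})) \<union> {r. j < r \<and> r < n \<and> E i r = b}) =
      card ({r. r < i \<and> E r j = b} \<union> (if E i j = b then {} else {i<..<j})) + card {r. j < r \<and> r < n \<and> E i r = b}"
    by (rule card_Un_disjoint) (use assms in \<open>auto split: if_splits\<close>)
  ultimately show ?thesis unfolding side_count_def eq by simp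
qed

text \<open>The edges \<open>i j\<close> with at most \<open>k\<close> vertices on the side that does not contain the last vertex \<open>n\<close>:
  their smaller side keeps its size when \<open>n\<close> is removed.\<close>

definition invariant_row :: "nat \<Rightarrow> (nat \<Rightarrow> nat \<Rightarrow> bool) \<Rightarrow> nat \<Rightarrow> nat \<Rightarrow> nat set" where
  "invariant_row n E k i = {j. i < j \<and> j < n \<and> side_count (Suc n) E i j (\<not> E i n) \<le> k}"

lemma finite_invariant_row [simp]: "finite (invariant_row n E k i)"
  by (rule finite_subset[of _ "{..<n}"]) (auto simp: invariant_row_def)

text \<open>Read the row of \<open>i\<close> from its far end, \<open>t = n - 1 - j\<close>,
  coloured by membership in page \<open>b\<close>. The fan rank of \<open>t\<close> counts the
  vertices after \<open>i\<close> on the side avoiding \<open>n\<close>, so each of the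
  \<open>k + 1 - i\<close> ranks below \<open>k + 1 - i\<close> gives an edge in the row.\<close>

lemma card_invariant_row_ge:
  assumes "k + 2 \<le> n"
  shows "k + 1 - i \<le> card (invariant_row n E k i)"
proof (cases "i \<le> k")
  case True
  define b where "b = (\<not> E i n)"
  define f where "f = (\<lambda>t. E i (n - 1 - t) = b)"
  define M where "M = {t. t < n - 1 - i \<and> fan_rank f (n - 1 - i) t < k + 1 - i}"
  have "card M = k + 1 - i"
    unfolding M_def using assms by (intro card_fan_rank_less) auto
  moreover have "card M = card ((\<lambda>t. n - 1 - t) ` M)"
    by (rule card_image[symmetric]) (auto simp: M_def inj_on_def)
  moreover have "(\<lambda>t. n - 1 - t) ` M \<subseteq> invariant_row n E k i"
  proof
    fix j assume "j \<in> (\<lambda>t. n - 1 - t) ` M"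
    then obtain t where t: "t < n - 1 - i" "fan_rank f (n - 1 - i) t < k + 1 - i" and j: "j = n - 1 - t"
      by (auto simp: M_def)
    have ij: "i < j" "j < n" using t j by auto
    have "{r. j < r \<and> r < n \<and> E i r = b} = (\<lambda>t. n - 1 - t) ` {u. u < t \<and> f u}"
    proof (intro equalityI subsetI)
      fix r assume "r \<in> {r. j < r \<and> r < n \<and> E i r = b}"
      then have "n - 1 - r \<in> {u. u < t \<and> f u}" "r = n - 1 - (n - 1 - r)"
        using j t(1) by (auto simp: f_def)
      then show "r \<in> (\<lambda>t. n - 1 - t) ` {u. u < t \<and> f u}" by blast
    qed (use j t(1) in \<open>auto simp: f_def\<close>)
    moreover have "inj_on (\<lambda>t. n - 1 - t) {u. u < t \<and> f u}"
      using t(1) by (auto simp: inj_on_def)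
    ultimately have c: "card {r. j < r \<and> r < n \<and> E i r = b} = card {u. u < t \<and> f u}"
      by (simp add: card_image)
    \<comment> \<open>The vertices before \<open>i\<close> can add at most \<open>i\<close> to the
      side.\<close>
    have "card {r. r < i \<and> E r j = b} \<le> card {..<i}" by (rule card_mono) auto
    then have "side_count (Suc n) E i j b \<le> i + fan_rank f (n - 1 - i) t"
      unfolding side_count_row[where E = E, OF ij b_def] c fan_rank_def using t(1) j by (auto simp: f_def)
    then show "j \<in> invariant_row n E k i" using t(2) ij by (auto simp: invariant_row_def b_def)
  qed
  ultimately show ?thesis by (metis card_mono finite_invariant_row)
qed simp

lemma sum_diff_lessThan:
  fixes k n :: nat
  assumes "k \<le> n" shows "2 * (\<Sum>i<n. k - i) = k * (k + 1)"
  using assms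
proof (induction k arbitrary: n)
  case (Suc k)
  then obtain m where n: "n = Suc m" by (cases n) auto
  have "(\<Sum>i<n. Suc k - i) = Suc k + (\<Sum>i<m. k - i)"
    unfolding n by (subst sum.lessThan_Suc_shift) simp
  then show ?case using Suc n by (simp add: algebra_simps)
qed simp

text \<open>The left counts of the edges at \<open>n\<close> run through all \<open>l < n\<close>.
  Because \<open>2 * k \<le> n\<close>, the differences \<open>k - l\<close> and
  \<open>k - (n - 1 - l)\<close> are never both positive, so their sum bounds each summand from
  below.\<close>

lemma sum_last_ge:
  assumes "2 * k \<le> n"
  shows "k * (k + 1) \<le> (\<Sum>i<n. k - min (side_count (Suc n) E i n True) (side_count (Suc n) E i n False))"
proof -
  have "(\<Sum>i<n. k - min (side_count (Suc n) E i n True) (side_count (Suc n) E i n False)) =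
      (\<Sum>i<n. k - min (fan_rank (\<lambda>r. E r n) n i) (n - 1 - fan_rank (\<lambda>r. E r n) n i))"
  proof (rule sum.cong)
    fix i assume "i \<in> {..<n}"
    then have "side_count (Suc n) E i n True + side_count (Suc n) E i n False = n - 1"
      using side_count_add[of i n "Suc n" E] by simp
    then have "side_count (Suc n) E i n False = n - 1 - side_count (Suc n) E i n True" by linarith
    then show "k - min (side_count (Suc n) E i n True) (side_count (Suc n) E i n False) =
        k - min (fan_rank (\<lambda>r. E r n) n i) (n - 1 - fan_rank (\<lambda>r. E r n) n i)"
      using side_count_last[of i n E] \<open>i \<in> {..<n}\<close> by simp
  qed simp
  also have "\<dots> = (\<Sum>l<n. k - min l (n - 1 - l))"
    by (rule sum.reindex_bij_betw[OF bij_betw_fan_rank])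
  also have "\<dots> \<ge> (\<Sum>l<n. (k - l) + (k - (n - 1 - l)))"
    using assms by (intro sum_mono) auto
  also have "(\<Sum>l<n. (k - l) + (k - (n - 1 - l))) = (\<Sum>l<n. k - l) + (\<Sum>l<n. k - (n - 1 - l))"
    by (rule sum.distrib)
  also have "(\<Sum>l<n. k - (n - 1 - l)) = (\<Sum>l<n. k - l)"
    using sum.nat_diff_reindex[of "\<lambda>l. k - l" n] by simp
  finally show ?thesis using sum_diff_lessThan[of k n] assms by simp
qed

text \<open>Raising the threshold from \<open>k\<close> to \<open>k + 1\<close> compensates for a
  smaller side that receives \<open>n\<close>, and gains 1 for every edge in an invariant row. The
  edges at \<open>n\<close> supply \<open>(k + 1) * (k + 2)\<close>. The bound on \<open>n\<close>
  ensures that a side with at most \<open>k\<close> vertices is the smaller one.\<close>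

lemma edge_weight_Suc_ge:
  assumes "2 * k + 2 \<le> n"
  shows "edge_weight n E k + (k + 1) * (k + 2) + (\<Sum>i<n. card (invariant_row n E k i)) \<le> edge_weight (Suc n) E (Suc k)"
proof -
  let ?m = "\<lambda>N i j. min (side_count N E i j True) (side_count N E i j False)"
  have "(\<Sum>i<n. card (invariant_row n E k i)) = card (Sigma {..<n} (invariant_row n E k))"
    by simp
  also have "Sigma {..<n} (invariant_row n E k) = pairs n \<inter> {(i, j). side_count (Suc n) E i j (\<not> E i n) \<le> k}"
    by (auto simp: invariant_row_def pairs_def)
  also have "card \<dots> = (\<Sum>(i, j)\<in>pairs n. of_bool (side_count (Suc n) E i j (\<not> E i n) \<le> k))"
    by (simp add: case_prod_unfold)
  finally have "edge_weight n E k + (\<Sum>i<n. card (invariant_row n E k i)) =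
      (\<Sum>(i, j)\<in>pairs n. (k - ?m n i j) + of_bool (side_count (Suc n) E i j (\<not> E i n) \<le> k))"
    unfolding edge_weight_def by (simp add: sum.distrib case_prod_unfold)
  also have "\<dots> \<le> (\<Sum>(i, j)\<in>pairs n. Suc k - ?m (Suc n) i j)"
  proof (rule sum_mono, clarify)
    fix i j assume "(i, j) \<in> pairs n"
    then have ij: "i < j" "j < n" by (auto simp: pairs_def)
    show "(k - ?m n i j) + of_bool (side_count (Suc n) E i j (\<not> E i n) \<le> k) \<le> Suc k - ?m (Suc n) i j"
      using side_count_add[OF ij, of E] assms by (cases "E i n") (auto simp: side_count_Suc[OF ij])
  qed
  finally have 1: "edge_weight n E k + (\<Sum>i<n. card (invariant_row n E k i)) \<le> (\<Sum>(i, j)\<in>pairs n. Suc k - ?m (Suc n) i j)" .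
  have "edge_weight (Suc n) E (Suc k) = (\<Sum>(i, j)\<in>pairs n. Suc k - ?m (Suc n) i j) +
      (\<Sum>(i, j)\<in>(\<lambda>i. (i, n)) ` {..<n}. Suc k - ?m (Suc n) i j)"
    unfolding edge_weight_def pairs_Suc by (rule sum.union_disjoint) (simp_all add: disjoint_iff image_iff, simp add: pairs_def)
  also have "(\<Sum>(i, j)\<in>(\<lambda>i. (i, n)) ` {..<n}. Suc k - ?m (Suc n) i j) = (\<Sum>i<n. Suc k - ?m (Suc n) i n)"
    by (subst sum.reindex) (auto simp: inj_on_def)
  finally show ?thesis using 1 sum_last_ge[of "Suc k" n E] assms by simp
qed

lemma sum_card_invariant_row_ge:
  assumes "k + 2 \<le> n"
  shows "(k + 1) * (k + 2) \<le> 2 * (\<Sum>i<n. card (invariant_row n E k i))"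
proof -
  have "2 * (\<Sum>i<n. k + 1 - i) \<le> 2 * (\<Sum>i<n. card (invariant_row n E k i))"
    using card_invariant_row_ge[OF assms] by (intro mult_le_mono2 sum_mono) auto
  then show ?thesis using sum_diff_lessThan[of "k + 1" n] assms by simp
qed

text \<open>Induction by deleting the last vertex. Twice the weight grows by at least
  \<open>3 * (k + 1) * (k + 2)\<close>: two thirds come from the edges at the deleted vertex, one
  third from the invariant rows.\<close>

lemma edge_weight_ge:
  assumes "2 * k + 1 \<le> n"
  shows "k * (k + 1) * (k + 2) \<le> 2 * edge_weight n E k"
  using assms
proof (induction k arbitrary: n)
  case (Suc k)
  then obtain m where n: "n = Suc m" by (cases n) auto
  have m: "2 * k + 2 \<le> m" using Suc.prems n by simp
  have "k * (k + 1) * (k + 2) \<le> 2 * edge_weight m E k" using Suc.IH[of m] m by simp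
  then have "k * (k + 1) * (k + 2) + 2 * ((k + 1) * (k + 2)) + (k + 1) * (k + 2) \<le> 2 * edge_weight n E (Suc k)"
    using edge_weight_Suc_ge[OF m, of E] sum_card_invariant_row_ge[of k m E] m unfolding n by linarith
  then show ?case by (simp add: algebra_simps)
qed simp

text \<open>If the weight attains its bound, no step of the induction has slack. The row sizes then
  add up to the sum of their lower bounds, so each row attains its own.\<close>

lemma card_invariant_row_eq:
  assumes "2 * k + 2 \<le> n" "2 * edge_weight (Suc n) E (Suc k) = (k + 1) * (k + 2) * (k + 3)" "i < n"
  shows "card (invariant_row n E k i) = k + 1 - i"
proof -
  have "k * (k + 1) * (k + 2) \<le> 2 * edge_weight n E k" using edge_weight_ge assms(1) by simp
  moreover have "(k + 1) * (k + 2) * (k + 3) = k * (k + 1) * (k + 2) + 3 * ((k + 1) * (k + 2))"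
    by (simp add: algebra_simps)
  ultimately have "2 * (\<Sum>i<n. card (invariant_row n E k i)) \<le> (k + 1) * (k + 2)"
    using edge_weight_Suc_ge[OF assms(1), of E] assms(2) by linarith
  also have "\<dots> = 2 * (\<Sum>i<n. k + 1 - i)"
    using sum_diff_lessThan[of "k + 1" n] assms(1) by simp
  finally have "(\<Sum>i<n. card (invariant_row n E k i)) = (\<Sum>i<n. k + 1 - i)"
    using sum_mono[of "{..<n}" "\<lambda>i. k + 1 - i" "\<lambda>i. card (invariant_row n E k i)"] card_invariant_row_ge[of k n _ E] assms(1) by simp
  then show ?thesis
    using sum_mono_inv[of "\<lambda>i. k + 1 - i" "{..<n}" "\<lambda>i. card (invariant_row n E k i)" i]
      card_invariant_row_ge[of k n _ E] assms(1,3) by simp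
qed

section \<open>Crossings as a sum of edge weights for odd n\<close>

lemma double_sum_diff: "2 * (\<Sum>k = 1..M. k - c) = (M - c) * (M - c + 1)" for c :: nat
proof (induction M)
  case (Suc M)
  show ?case
  proof (cases "c \<le> M")
    case True
    then obtain d where "M = c + d" by (auto simp: le_iff_add)
    then show ?thesis using Suc by (simp add: algebra_simps Suc_diff_le)
  next
    case False
    then show ?thesis using Suc by simp
  qed
qed simp

text \<open>With \<open>x\<close> the size of the smaller side, the product of the sides is
  \<open>x * (2 * m - 1 - x) = m * (m - 1) - (m - 1 - x) * (m - x)\<close>, and by
  \<open>double_sum_diff\<close> the subtracted product is twice the sum of \<open>k - x\<close>
  over \<open>k\<close> up to \<open>m - 1\<close>.\<close>

lemma sum_edge_weight:
  assumes "n = 2 * m + 1" "1 \<le> m"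
  shows "(\<Sum>(i, j)\<in>pairs n. side_count n E i j True * side_count n E i j False) + (\<Sum>k = 1..m - 1. 2 * edge_weight n E k) =
    card (pairs n) * (m * (m - 1))"
proof -
  have "(\<Sum>k = 1..m - 1. 2 * edge_weight n E k) =
      (\<Sum>(i, j)\<in>pairs n. 2 * (\<Sum>k = 1..m - 1. k - min (side_count n E i j True) (side_count n E i j False)))"
    unfolding edge_weight_def case_prod_unfold sum_distrib_left by (rule sum.swap)
  then have "(\<Sum>(i, j)\<in>pairs n. side_count n E i j True * side_count n E i j False) + (\<Sum>k = 1..m - 1. 2 * edge_weight n E k) =
      (\<Sum>(i, j)\<in>pairs n. side_count n E i j True * side_count n E i j False +
         2 * (\<Sum>k = 1..m - 1. k - min (side_count n E i j True) (side_count n E i j False)))"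
    by (simp add: sum.distrib case_prod_unfold)
  also have "\<dots> = (\<Sum>(i, j)\<in>pairs n. m * (m - 1))"
  proof (rule sum.cong, simp, clarify)
    fix i j assume "(i, j) \<in> pairs n"
    then have add: "side_count n E i j True + side_count n E i j False = 2 * m - 1"
      using side_count_add[of i j n E] assms by (auto simp: pairs_def)
    have key: "x * (2 * m - 1 - x) + (m - 1 - x) * (m - 1 - x + 1) = m * (m - 1)" if "x \<le> m - 1" for x
    proof -
      from that assms(2) obtain d where "m = x + d + 1"
        by (metis Suc_eq_plus1 Suc_pred' le_add_diff_inverse less_le_trans zero_less_one)
      then show ?thesis by (simp add: algebra_simps)
    qed
    let ?x = "min (side_count n E i j True) (side_count n E i j False)"
    have "?x \<le> m - 1" using add by linarith
    moreover have "side_count n E i j True * side_count n E i j False = ?x * (2 * m - 1 - ?x)"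
    proof (cases "side_count n E i j True \<le> side_count n E i j False")
      case True
      then have "?x = side_count n E i j True" "side_count n E i j False = 2 * m - 1 - ?x" using add by linarith+
      then show ?thesis by simp
    next
      case False
      then have "?x = side_count n E i j False" "side_count n E i j True = 2 * m - 1 - ?x" using add by linarith+
      then show ?thesis by simp
    qed
    ultimately show "side_count n E i j True * side_count n E i j False + 2 * (\<Sum>k = 1..m - 1. k - ?x) = m * (m - 1)"
      unfolding double_sum_diff using key by simp
  qed
  also have "\<dots> = card (pairs n) * (m * (m - 1))" by (simp add: case_prod_unfold)
  finally show ?thesis .
qed

lemma sum_prod3: "4 * (\<Sum>k = 1..M. k * (k + 1) * (k + 2)) = M * (M + 1) * (M + 2) * (M + 3)" for M :: nat
  by (induction M) (auto simp: algebra_simps)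

text \<open>The crossing count is the sum of the doubled edge weights up to a constant depending
  only on \<open>n\<close>. Inserting the lower bounds for the weights gives exactly
  \<open>Z n\<close>, so optimality forces equality in every one of them.\<close>

lemma edge_weight_if_optimal:
  assumes "n = 2 * m + 1" "crossing_count n E = Z n" "1 \<le> k" "k \<le> m - 1"
  shows "2 * edge_weight n E k = k * (k + 1) * (k + 2)"
proof -
  obtain a where m: "m = Suc a" using assms by (cases m) auto
  have "Z n = (m * m * a * a) div 4"
    unfolding Z_def assms(1) m by (simp add: algebra_simps)
  \<comment> \<open>The factor \<open>m * a\<close> is a product of consecutive numbers, hence even,
    and the division in \<open>Z\<close> is exact.\<close>
  moreover have "4 dvd m * m * a * a"
  proof -
    have "even (m * a)" by (simp add: m)
    then have "2 * 2 dvd (m * a) * (m * a)" by (intro mult_dvd_mono)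
    then show ?thesis by (simp add: algebra_simps)
  qed
  ultimately have Z: "4 * crossing_count n E = m * m * a * a" using assms(2) by (metis dvd_mult_div_cancel)
  let ?edge_weight = "\<Sum>k = 1..m - 1. 2 * edge_weight n E k"
  have 1: "3 * card (quads n) + ?edge_weight = card (pairs n) * (m * (m - 1)) + crossing_count n E"
    using sum_edge_weight[OF assms(1), of E] sum_side_count_mult[of n E] m by simp
  have P: "card (pairs n) = n * m" using card_pairs[of n] assms(1) by simp
  have Q: "6 * card (quads n) = n * m * (2 * m - 1) * a"
    using card_quads[of n] unfolding assms(1) m by (simp add: algebra_simps)
  have "4 * ?edge_weight + 2 * (n * m * (2 * m - 1) * a) = 4 * (n * m * (m * a)) + m * m * a * a"
    using 1 P Q Z m by simp
  moreover have "a * (a + 1) * (a + 2) * (a + 3) + 2 * (n * m * (2 * m - 1) * a) =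
      4 * (n * m * (m * a)) + m * m * a * a"
    unfolding assms(1) m by (simp add: algebra_simps)
  ultimately have "4 * ?edge_weight = a * (a + 1) * (a + 2) * (a + 3)" by linarith
  then have "(\<Sum>k = 1..m - 1. k * (k + 1) * (k + 2)) = ?edge_weight"
    using sum_prod3[of "m - 1"] m by simp
  moreover have "i * (i + 1) * (i + 2) \<le> 2 * edge_weight n E i" if "i \<in> {1..m - 1}" for i
    using that edge_weight_ge[of i n E] assms(1) by auto
  ultimately have "k * (k + 1) * (k + 2) = 2 * edge_weight n E k"
    by (rule sum_mono_inv) (use assms in auto)
  then show ?thesis by simp
qed

section \<open>Tightness at the third vertex\<close>

text \<open>Row 2 must have size \<open>k + 1 - 2\<close>, which is 0 for \<open>k = 1\<close> and 1
  for \<open>k = 2\<close>. The weights needed are those for 2 and 3; the latter requires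
  \<open>3 \<le> m - 1\<close>, hence \<open>9 \<le> n\<close>.\<close>

lemma optimal_row2:
  assumes "odd n" "9 \<le> n" "crossing_count n E = Z n"
  shows "invariant_row (n - 1) E 1 2 = {}" "card (invariant_row (n - 1) E 2 2) = 1"
proof -
  obtain m where m: "n = 2 * m + 1" using assms(1) by (elim oddE)
  have n: "Suc (n - 1) = n" using assms(2) by simp
  have "2 * edge_weight n E 2 = 24" "2 * edge_weight n E 3 = 60"
    using edge_weight_if_optimal[OF m assms(3), of 2] edge_weight_if_optimal[OF m assms(3), of 3] m assms(2) by simp_all
  then have "card (invariant_row (n - 1) E 1 2) = 0" "card (invariant_row (n - 1) E 2 2) = 1"
    using card_invariant_row_eq[of 1 "n - 1" E 2] card_invariant_row_eq[of 2 "n - 1" E 2] assms(2) n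
    by (simp_all add: eval_nat_numeral)
  then show "invariant_row (n - 1) E 1 2 = {}" "card (invariant_row (n - 1) E 2 2) = 1" by simp_all
qed

lemma card_below2: "card {r. r < (2::nat) \<and> P r} = of_bool (P 0) + of_bool (P 1)"
proof -
  have "{r. r < (2::nat) \<and> P r} = (if P 0 then {0} else {}) \<union> (if P 1 then {1} else {})"
    by (auto dest!: less_2_cases)
  then show ?thesis by simp
qed

lemma row2_iff:
  assumes "2 < j" "j < n - 1" "c = E 2 (n - 1)"
  shows "j \<in> invariant_row (n - 1) E k 2 \<longleftrightarrow>
    of_bool (E 0 j \<noteq> c) + of_bool (E 1 j \<noteq> c) + (if E 2 j \<noteq> c then 0 else j - 3) +
    card {r. j < r \<and> r < n - 1 \<and> E 2 r \<noteq> c} \<le> k"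
proof -
  have "(E x y = (\<not> c)) = (E x y \<noteq> c)" for x y by auto
  then show ?thesis
    using assms side_count_row[OF assms(1,2) refl, of E] by (simp add: invariant_row_def card_below2)
qed

text \<open>The situation of a non-crossed edge joining \<open>1\<close> and \<open>d + 1\<close>:
  all edges between \<open>{2..d}\<close> and the other side are in the opposite page
  \<open>c\<close>. Let \<open>q\<close> be the last vertex among \<open>4..d\<close> whose edge to
  \<open>2\<close> is not in \<open>c\<close>, or 3 if there is none. If \<open>2 (d + 1)\<close> is
  in \<open>c\<close>, then \<open>q\<close> lies in the row for \<open>k = 1\<close>, which is
  empty; otherwise \<open>q\<close> and \<open>d + 1\<close> both lie in the row for
  \<open>k = 2\<close>, a singleton.\<close>

lemma no_long_separated:
  assumes "odd n" "9 \<le> n" "crossing_count n E = Z n" "3 \<le> d" "d + 3 \<le> n"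
    and 0: "\<And>p. 2 \<le> p \<Longrightarrow> p \<le> d \<Longrightarrow> E 0 p = c"
    and c: "\<And>p q. 2 \<le> p \<Longrightarrow> p \<le> d \<Longrightarrow> d + 2 \<le> q \<Longrightarrow> q < n \<Longrightarrow> E p q = c"
  shows False
proof -
  \<comment> \<open>The edges from 2 to \<open>q\<close> and \<open>d + 1\<close> have rank at most 1, hence too few vertices on one side.\<close>
  define U where "U = {3} \<union> {r. 4 \<le> r \<and> r \<le> d \<and> E 2 r \<noteq> c}"
  define q where "q = Max U"
  have "finite U" by (rule finite_subset[of _ "{..d}"]) (use assms(4) in \<open>auto simp: U_def\<close>)
  moreover have "U \<noteq> {}" by (simp add: U_def)
  ultimately have "q \<in> U" unfolding q_def by (rule Max_in)
  have q_max: "r \<le> q" if "r \<in> U" for r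
    unfolding q_def using \<open>finite U\<close> that by (rule Max_ge)
  have q: "3 \<le> q" "q \<le> d" "q = 3 \<or> E 2 q \<noteq> c" using \<open>q \<in> U\<close> assms(4) by (auto simp: U_def)
  have cn: "c = E 2 (n - 1)" using c[of 2 "n - 1"] assms(4,5) by simp
  have sub: "{r. q < r \<and> r < n - 1 \<and> E 2 r \<noteq> c} \<subseteq> {d + 1} \<inter> {r. E 2 r \<noteq> c}"
  proof
    fix r assume "r \<in> {r. q < r \<and> r < n - 1 \<and> E 2 r \<noteq> c}"
    then have r: "q < r" "r < n - 1" "E 2 r \<noteq> c" by auto
    have "\<not> r \<le> d" using r q(1) q_max[of r] by (auto simp: U_def)
    moreover have "\<not> d + 2 \<le> r" using r c[of 2 r] assms(4) by fastforce
    ultimately show "r \<in> {d + 1} \<inter> {r. E 2 r \<noteq> c}" using r by auto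
  qed
  \<comment> \<open>Vertex 0 contributes nothing by assumption, and the vertices between 2 and
    \<open>q\<close> contribute nothing because either the page differs from \<open>c\<close> or
    \<open>q - 3 = 0\<close>. Only vertex 1 may count.\<close>
  have le: "of_bool (E 0 q \<noteq> c) + of_bool (E 1 q \<noteq> c) + (if E 2 q \<noteq> c then 0 else q - 3) \<le> (1::nat)"
    using 0[of q] q by auto
  have iff: "q \<in> invariant_row (n - 1) E k 2 \<longleftrightarrow>
    of_bool (E 0 q \<noteq> c) + of_bool (E 1 q \<noteq> c) + (if E 2 q \<noteq> c then 0 else q - 3) +
    card {r. q < r \<and> r < n - 1 \<and> E 2 r \<noteq> c} \<le> k" for k
    by (rule row2_iff) (use q assms(5) cn in auto)
  show False
  proof (cases "E 2 (d + 1) = c")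
    case True
    then have "{r. q < r \<and> r < n - 1 \<and> E 2 r \<noteq> c} = {}" using sub by auto
    then have "card {r. q < r \<and> r < n - 1 \<and> E 2 r \<noteq> c} = 0" by (simp only: card.empty)
    then have "q \<in> invariant_row (n - 1) E 1 2" using le unfolding iff by linarith
    then show False using optimal_row2[OF assms(1-3)] by simp
  next
    case False
    have "card {r. q < r \<and> r < n - 1 \<and> E 2 r \<noteq> c} \<le> card {d + 1}"
      by (rule card_mono) (use sub in auto)
    then have q2: "q \<in> invariant_row (n - 1) E 2 2" using le unfolding iff by simp
    have "{r. d + 1 < r \<and> r < n - 1 \<and> E 2 r \<noteq> c} = {}"
      using c[of 2] assms(4) by auto
    then have "card {r. d + 1 < r \<and> r < n - 1 \<and> E 2 r \<noteq> c} = 0" by (simp only: card.empty)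
    moreover have "of_bool (E 0 (d + 1) \<noteq> c) + of_bool (E 1 (d + 1) \<noteq> c) +
        (if E 2 (d + 1) \<noteq> c then 0 else d + 1 - 3) \<le> (2::nat)" using False by simp
    ultimately have "d + 1 \<in> invariant_row (n - 1) E 2 2"
      by (subst row2_iff[where E = E, OF _ _ cn]) (use assms(4,5) in linarith)+
    with q2 have "{q, d + 1} \<subseteq> invariant_row (n - 1) E 2 2" by simp
    then have "card {q, d + 1} \<le> 1" using optimal_row2(2)[OF assms(1-3)] by (metis card_mono finite_invariant_row)
    then show False using q by simp
  qed
qed

text \<open>Applies when \<open>1 3\<close> is non-crossed, as all edges from 2 to
  \<open>4, ..., n - 1\<close> then share a page. No vertex beyond \<open>j\<close> counts, so 3
  stays out of the empty row for \<open>k = 1\<close> only if both \<open>0 3\<close> and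
  \<open>1 3\<close> avoid \<open>c\<close>. Then 3 fills the row for \<open>k = 2\<close>, which 4
  would enter too if \<open>1 4\<close> were in \<open>c\<close>.\<close>

lemma monochromatic_vertex:
  assumes "odd n" "9 \<le> n" "crossing_count n E = Z n"
    and c: "\<And>r. 4 \<le> r \<Longrightarrow> r < n \<Longrightarrow> E 2 r = c"
  shows "E 0 3 \<noteq> c" "E 1 4 \<noteq> c"
proof -
  have cn: "c = E 2 (n - 1)" using c[of "n - 1"] assms(2) by simp
  have e: "{r. j < r \<and> r < n - 1 \<and> E 2 r \<noteq> c} = {}" if "3 \<le> j" for j
    using c that by auto
  have iff: "j \<in> invariant_row (n - 1) E k 2 \<longleftrightarrow>
      of_bool (E 0 j \<noteq> c) + of_bool (E 1 j \<noteq> c) + (if E 2 j \<noteq> c then 0 else j - 3) \<le> k"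
    if "3 \<le> j" "j < n - 1" for j k
    using row2_iff[of j n c E k] that cn unfolding e[OF that(1)] by simp
  have "3 < n - 1" "4 < n - 1" using assms(2) by simp_all
  note iff3 = iff[OF order_refl this(1)] and iff4 = iff[OF _ this(2), simplified]
  have "3 \<notin> invariant_row (n - 1) E 1 2" using optimal_row2[OF assms(1-3)] by simp
  then have 03: "E 0 3 \<noteq> c" "E 1 3 \<noteq> c" unfolding iff3 by (auto simp: of_bool_def split: if_splits)
  then show "E 0 3 \<noteq> c" by simp
  have r3: "3 \<in> invariant_row (n - 1) E 2 2" unfolding iff3 using 03 by simp
  show "E 1 4 \<noteq> c"
  proof
    assume "E 1 4 = c"
    then have "4 \<in> invariant_row (n - 1) E 2 2" using iff4[of 2] by (simp add: of_bool_def split: if_splits)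
    with r3 have "{3, 4} \<subseteq> invariant_row (n - 1) E 2 2" by simp
    then have "card {3, 4 :: nat} \<le> 1" using optimal_row2(2)[OF assms(1-3)] by (metis card_mono finite_invariant_row)
    then show False by simp
  qed
qed

section \<open>Rotations\<close>

text \<open>\<open>E'\<close> is \<open>E\<close> with each label lowered by 1 and vertex 0 becoming
  \<open>n - 1\<close>. Interleaving is a cyclic property; when the last vertex wraps around to 0,
  the two edges of the quadruple exchange roles.\<close>

lemma crossing_count_rotate:
  assumes a: "\<And>i j. i < j \<Longrightarrow> Suc j < n \<Longrightarrow> E' i j = E (Suc i) (Suc j)"
    and b: "\<And>i. Suc i < n \<Longrightarrow> E' i (n - 1) = E 0 (Suc i)"
  shows "crossing_count n E' = crossing_count n E"
proof -
  let ?f = "\<lambda>(i, k, j, l). if l = n - 1 then (0, Suc i, Suc k, Suc j) else (Suc i, Suc k, Suc j, Suc l)"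
  let ?g = "\<lambda>(i, k, j, l). if i = 0 then (k - 1, j - 1, l - 1, n - 1) else (i - 1, k - 1, j - 1, l - 1)"
  let ?S = "\<lambda>E. {(i, k, j, l). i < k \<and> k < j \<and> j < l \<and> l < n \<and> E i j = E k l}"
  have "bij_betw ?f (?S E') (?S E)"
  proof (rule bij_betw_byWitness[where f' = ?g])
    show "?f ` ?S E' \<subseteq> ?S E" using a b by (auto split: if_splits)
    show "?g ` ?S E \<subseteq> ?S E'"
    proof
      fix y assume "y \<in> ?g ` ?S E"
      then obtain i k j l where y: "y = ?g (i, k, j, l)"
        and *: "i < k" "k < j" "j < l" "l < n" "E i j = E k l" by auto
      show "y \<in> ?S E'"
      proof (cases "i = 0")
        case True
        then have "E' (k - 1) (l - 1) = E k l" "E' (j - 1) (n - 1) = E 0 j"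
          using * a[of "k - 1" "l - 1"] b[of "j - 1"] by simp_all
        then show ?thesis using * True by (auto simp: y)
      next
        case False
        then have "E' (i - 1) (j - 1) = E i j" "E' (k - 1) (l - 1) = E k l"
          using * a[of "i - 1" "j - 1"] a[of "k - 1" "l - 1"] by simp_all
        then show ?thesis using * False by (auto simp: y)
      qed
    qed
  qed (auto split: if_splits)
  then show ?thesis unfolding crossing_count_def by (rule bij_betw_same_card)
qed

lemma crossing_number_eq_crossing_count: "crossing_number n D = crossing_count n (\<lambda>i j. D (Suc i) (Suc j))"
proof -
  let ?S = "{(i, k, j, l). i < k \<and> k < j \<and> j < l \<and> l < n \<and> D (Suc i) (Suc j) = D (Suc k) (Suc l)}"
  let ?h = "\<lambda>(i, k, j, l). {{Suc i, Suc j}, {Suc k, Suc l}}"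
  have cross: "{e, f} \<in> ?h ` ?S" if ed: "e \<in> edges n" "f \<in> edges n" "cross_ord D e f" for e f
  proof -
    obtain i j k l where *: "e = {i, j}" "f = {k, l}" "D i j = D k l" "i < k" "k < j" "j < l"
      using ed(3) by (auto simp: cross_ord_def)
    have "1 \<le> i" "l \<le> n" using ed(1,2) * by (auto simp: edges_def doubleton_eq_iff)
    then show ?thesis using *
      by (intro image_eqI[of _ _ "(i - 1, k - 1, j - 1, l - 1)"]) auto
  qed
  have "{{e, f} | e f. e \<in> edges n \<and> f \<in> edges n \<and> crosses D e f} = ?h ` ?S"
  proof (intro equalityI subsetI)
    fix x assume "x \<in> {{e, f} | e f. e \<in> edges n \<and> f \<in> edges n \<and> crosses D e f}"
    then obtain e f where x: "x = {e, f}" and ed: "e \<in> edges n" "f \<in> edges n"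
      and "cross_ord D e f \<or> cross_ord D f e"
      unfolding crosses_def by blast
    moreover have x': "x = {f, e}" unfolding x by (rule insert_commute)
    ultimately show "x \<in> ?h ` ?S"
      using cross[OF ed, folded x] cross[OF ed(2,1), folded x'] by (elim disjE)
  next
    fix x assume "x \<in> ?h ` ?S"
    then obtain i k j l where *: "i < k" "k < j" "j < l" "l < n" "D (Suc i) (Suc j) = D (Suc k) (Suc l)"
      and x: "x = {{Suc i, Suc j}, {Suc k, Suc l}}" by auto
    have "cross_ord D {Suc i, Suc j} {Suc k, Suc l}"
      unfolding cross_ord_def using * by (intro exI[of _ "Suc i"] exI[of _ "Suc j"] exI[of _ "Suc k"] exI[of _ "Suc l"]) auto
    moreover have "{Suc a, Suc b} \<in> edges n" if "a < b" "b < n" for a b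
      unfolding edges_def using that by (intro CollectI exI[of _ "Suc a"] exI[of _ "Suc b"]) simp
    then have "{Suc i, Suc j} \<in> edges n" "{Suc k, Suc l} \<in> edges n" using * by simp_all
    ultimately show "x \<in> {{e, f} | e f. e \<in> edges n \<and> f \<in> edges n \<and> crosses D e f}"
      unfolding x crosses_def by blast
  qed
  moreover have "inj_on ?h ?S"
  proof (rule inj_onI)
    fix t u assume "t \<in> ?S" "u \<in> ?S" and eq: "?h t = ?h u"
    then obtain i k j l i' k' j' l' where t: "t = (i, k, j, l)" "i < k" "k < j" "j < l"
      and u: "u = (i', k', j', l')" "i' < k'" "k' < j'" "j' < l'" by blast
    from eq have "{{Suc i, Suc j}, {Suc k, Suc l}} = {{Suc i', Suc j'}, {Suc k', Suc l'}}" by (simp add: t u)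
    then have "{Suc i, Suc j} = {Suc i', Suc j'} \<and> {Suc k, Suc l} = {Suc k', Suc l'} \<or>
        {Suc i, Suc j} = {Suc k', Suc l'} \<and> {Suc k, Suc l} = {Suc i', Suc j'}"
      by (rule doubleton_eq_iff[THEN iffD1])
    \<comment> \<open>The edge with the smaller left endpoint comes first in a quadruple, which
      rules out the swapped matching.\<close>
    then have "i = i' \<and> j = j' \<and> k = k' \<and> l = l'"
      unfolding doubleton_eq_iff nat.inject using t(2-4) u(2-4) by linarith
    then show "t = u" using t u by simp
  qed
  ultimately show ?thesis unfolding crossing_number_def crossing_count_def by (simp add: card_image)
qed

section \<open>Cyclic labels and pages\<close>

definition vtx :: "nat \<Rightarrow> nat \<Rightarrow> nat" where
  "vtx n t = Suc (t mod n)"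

text \<open>\<open>D\<close> is meaningful only for increasing arguments, which cyclic labels need
  not respect. With indices taken modulo \<open>n\<close>, rotating the drawing by \<open>s\<close>
  just adds \<open>s\<close> to both indices.\<close>

definition page :: "nat \<Rightarrow> (nat \<Rightarrow> nat \<Rightarrow> bool) \<Rightarrow> nat \<Rightarrow> nat \<Rightarrow> bool" where
  "page n D t u = D (min (vtx n t) (vtx n u)) (max (vtx n t) (vtx n u))"

lemma vtx_add [simp]: "vtx n (t + n) = vtx n t" "vtx n (n + t) = vtx n t"
  by (simp_all add: vtx_def)

lemma page_commute: "page n D t u = page n D u t"
  by (simp add: page_def min.commute max.commute)

lemma page_add [simp]: "page n D (t + n) u = page n D t u" "page n D t (u + n) = page n D t u"
  by (simp_all add: page_def)

lemma crossing_count_page: "crossing_count n (\<lambda>i j. page n D (i + s) (j + s)) = crossing_number n D"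
proof (induction s)
  case 0
  have "{(i, k, j, l). i < k \<and> k < j \<and> j < l \<and> l < n \<and> page n D i j = page n D k l} =
      {(i, k, j, l). i < k \<and> k < j \<and> j < l \<and> l < n \<and> D (Suc i) (Suc j) = D (Suc k) (Suc l)}"
    by (auto simp: page_def vtx_def)
  then show ?case by (simp add: crossing_number_eq_crossing_count crossing_count_def)
next
  case (Suc s)
  have "crossing_count n (\<lambda>i j. page n D (i + Suc s) (j + Suc s)) = crossing_count n (\<lambda>i j. page n D (i + s) (j + s))"
  proof (rule crossing_count_rotate)
    fix i assume "Suc i < n"
    then have "n - 1 + Suc s = s + n" by simp
    then show "page n D (i + Suc s) (n - 1 + Suc s) = page n D (0 + s) (Suc i + s)"
      by (simp only: page_add) (simp add: page_commute)
  qed simp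
  then show ?case using Suc by simp
qed

lemma crossesI:
  assumes "x < z \<and> z < y \<and> y < w \<or> z < x \<and> x < w \<and> w < y" "D x y = D z w"
  shows "crosses D {x, y} {z, w}"
  using assms unfolding crosses_def cross_ord_def
  by (elim disjE) (rule disjI1, rule exI[of _ x], rule exI[of _ y], rule exI[of _ z], rule exI[of _ w], simp,
      rule disjI2, rule exI[of _ z], rule exI[of _ w], rule exI[of _ x], rule exI[of _ y], simp)

lemma mod_add_less_eq:
  fixes t e n :: nat
  assumes "0 < n" "e < n"
  shows "(t + e) mod n = (if t mod n + e < n then t mod n + e else t mod n + e - n)"
proof -
  have eq: "(t + e) mod n = (t mod n + e) mod n" by (simp add: mod_add_left_eq)
  show ?thesis
  proof (cases "t mod n + e < n")
    case False
    then have "(t + e) mod n = (t mod n + e - n) mod n" unfolding eq by (simp add: le_mod_geq)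
    also have "\<dots> = t mod n + e - n" using assms by (intro mod_less) (simp add: add_strict_mono less_diff_conv2 not_less[THEN iffD1, OF False])
    finally show ?thesis using False by simp
  qed (simp add: eq)
qed

section \<open>Non-crossed edges of optimal drawings\<close>

text \<open>The ends \<open>t\<close> and \<open>t + d\<close> cut the cycle into two arcs, with
  \<open>t + e\<close> in one and \<open>t + f\<close> in the other. The two edges therefore
  interleave and would cross in a common page.\<close>

lemma page_neq_if_non_crossed:
  assumes nc: "non_crossed n D {vtx n t, vtx n (t + d)}" and "0 < e" "e < d" "d < f" "f < n"
  shows "page n D (t + e) (t + f) = (\<not> page n D t (t + d))"
proof -
  define a where "a = t mod n"
  have n: "0 < n" "d < n" "e < n" "a < n" using assms by (auto simp: a_def)
  let ?x = "min (vtx n t) (vtx n (t + d))" and ?y = "max (vtx n t) (vtx n (t + d))"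
  let ?z = "min (vtx n (t + e)) (vtx n (t + f))" and ?w = "max (vtx n (t + e)) (vtx n (t + f))"
  have v: "vtx n t = Suc a" "vtx n (t + d) = Suc (if a + d < n then a + d else a + d - n)"
    "vtx n (t + e) = Suc (if a + e < n then a + e else a + e - n)"
    "vtx n (t + f) = Suc (if a + f < n then a + f else a + f - n)"
    using n \<open>f < n\<close> by (simp_all add: vtx_def a_def mod_add_less_eq)
  have "?x < ?z \<and> ?z < ?y \<and> ?y < ?w \<or> ?z < ?x \<and> ?x < ?w \<and> ?w < ?y"
    unfolding v using assms(2-5) n by auto
  then have "crosses D {?x, ?y} {?z, ?w}" if "page n D t (t + d) = page n D (t + e) (t + f)"
    using that by (intro crossesI) (auto simp: page_def)
  moreover have "{?x, ?y} = {vtx n t, vtx n (t + d)}" by (auto simp: min_def max_def)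
  moreover have "1 \<le> ?z" "?z < ?w" "?w \<le> n"
    unfolding v using assms(2-5) n by auto
  then have "{?z, ?w} \<in> edges n"
    unfolding edges_def by blast
  ultimately show ?thesis using nc unfolding non_crossed_def by metis
qed

lemma no_long_non_crossed:
  assumes "odd n" "9 \<le> n" "crossing_number n D = Z n" "3 \<le> d" "d + 3 \<le> n"
    and nc: "non_crossed n D {vtx n t, vtx n (t + d)}"
  shows False
proof -
  \<comment> \<open>Adding \<open>n - 1\<close> shifts cyclically by -1, so \<open>t\<close> becomes
    vertex 1, \<open>t + d\<close> becomes \<open>d + 1\<close>, and the third vertex 2 is
    \<open>t + 1\<close>.\<close>
  let ?s = "t + (n - 1)" and ?c = "\<not> page n D t (t + d)"
  have sh: "i + ?s = t + (i - 1) + n" if "1 \<le> i" for i using that assms(2) by simp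
  have "crossing_count n (\<lambda>i j. page n D (i + ?s) (j + ?s)) = Z n" using crossing_count_page assms(3) by simp
  moreover have "page n D (0 + ?s) (p + ?s) = ?c" if "2 \<le> p" "p \<le> d" for p
  proof -
    have "page n D (t + (p - 1)) ?s = ?c"
      by (rule page_neq_if_non_crossed[OF nc]) (use that assms(5) in auto)
    moreover have "p + ?s = t + (p - 1) + n" using that by (intro sh) simp
    ultimately show ?thesis by (simp only: add_0 page_add page_commute[of n D ?s])
  qed
  moreover have "page n D (p + ?s) (q + ?s) = ?c" if "2 \<le> p" "p \<le> d" "d + 2 \<le> q" "q < n" for p q
  proof -
    have "page n D (t + (p - 1)) (t + (q - 1)) = ?c"
      by (rule page_neq_if_non_crossed[OF nc]) (use that in auto)
    moreover have "p + ?s = t + (p - 1) + n" "q + ?s = t + (q - 1) + n" using that by (intro sh; simp)+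
    ultimately show ?thesis by (simp only: page_add)
  qed
  ultimately show False
    by (rule no_long_separated[where E = "\<lambda>i j. page n D (i + ?s) (j + ?s)", OF assms(1,2) _ assms(4,5)])
qed

text \<open>The edge \<open>t (t + 3)\<close> is compared with both. Numbering \<open>t\<close> as
  1, \<open>monochromatic_vertex(2)\<close> puts it in the page of \<open>t (t + 2)\<close>;
  numbering \<open>t\<close> as 0, \<open>monochromatic_vertex(1)\<close> puts it in the page of
  \<open>(t + 1) (t + 3)\<close>. But these two edges interleave, so being non-crossed they lie in
  different pages.\<close>

lemma no_consecutive_short_non_crossed:
  assumes "odd n" "9 \<le> n" "crossing_number n D = Z n"
    and nc1: "non_crossed n D {vtx n t, vtx n (t + 2)}"
    and nc2: "non_crossed n D {vtx n (t + 1), vtx n (t + 3)}"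
  shows False
proof -
  let ?s = "t + (n - 1)" and ?c = "\<not> page n D t (t + 2)"
  have "page n D (1 + ?s) (4 + ?s) \<noteq> ?c"
  proof (rule monochromatic_vertex(2)[where E = "\<lambda>i j. page n D (i + ?s) (j + ?s)", OF assms(1,2)])
    show "crossing_count n (\<lambda>i j. page n D (i + ?s) (j + ?s)) = Z n" using crossing_count_page assms(3) by simp
    fix r assume r: "4 \<le> r" "r < n"
    then have "page n D (t + 1) (t + (r - 1)) = ?c"
      by (intro page_neq_if_non_crossed[OF nc1]) auto
    moreover have "2 + ?s = t + 1 + n" "r + ?s = t + (r - 1) + n" using r by auto
    ultimately show "page n D (2 + ?s) (r + ?s) = ?c" by (simp only: page_add)
  qed
  moreover have "1 + ?s = t + n" "4 + ?s = t + 3 + n" using assms(2) by auto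
  ultimately have 1: "page n D t (t + 3) \<noteq> ?c" by (simp only: page_add not_False_eq_True)
  let ?d = "\<not> page n D (t + 1) (t + 1 + 2)"
  have nc2': "non_crossed n D {vtx n (t + 1), vtx n (t + 1 + 2)}"
    using nc2 by (simp add: eval_nat_numeral)
  have "page n D (0 + t) (3 + t) \<noteq> ?d"
  proof (rule monochromatic_vertex(1)[where E = "\<lambda>i j. page n D (i + t) (j + t)", OF assms(1,2)])
    show "crossing_count n (\<lambda>i j. page n D (i + t) (j + t)) = Z n" using crossing_count_page assms(3) by simp
    fix r assume r: "4 \<le> r" "r < n"
    then have "page n D (t + 1 + 1) (t + 1 + (r - 1)) = ?d"
      by (intro page_neq_if_non_crossed[OF nc2']) auto
    moreover have "t + 1 + 1 = 2 + t" "t + 1 + (r - 1) = r + t" using r by auto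
    ultimately show "page n D (2 + t) (r + t) = ?d" by (simp only:)
  qed
  moreover have "3 + t = t + 3" by simp
  ultimately have 2: "page n D t (t + 3) \<noteq> ?d" by (simp only: add_0 not_False_eq_True)
  have "page n D (t + 1 + 1) (t + 1 + (n - 1)) = ?d"
    using assms(2) by (intro page_neq_if_non_crossed[OF nc2']) auto
  moreover have "t + 1 + 1 = t + 2" "t + 1 + (n - 1) = t + n" using assms(2) by auto
  ultimately have "page n D t (t + 2) = ?d" by (simp only: page_add page_commute[of n D "t + 2"])
  with 1 2 show False by blast
qed

lemma vtx_shift_surj:
  assumes "x \<in> {1..n}" shows "\<exists>d<n. x = vtx n (t + d)"
proof (cases "t mod n < x")
  case True
  let ?d = "x - 1 - t mod n"
  have "?d < n" using assms by auto
  moreover have "(t + ?d) mod n = x - 1"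
    using True assms \<open>?d < n\<close> by (subst mod_add_less_eq) auto
  then have "x = vtx n (t + ?d)" using assms by (simp add: vtx_def)
  ultimately show ?thesis by blast
next
  case False
  let ?d = "x - 1 + n - t mod n"
  have "t mod n < n" using assms by auto
  then have "?d < n" using False assms by auto
  moreover have "t mod n + ?d = x - 1 + n" using \<open>t mod n < n\<close> by linarith
  then have "(t + ?d) mod n = (x - 1 + n) mod n" by (metis mod_add_left_eq)
  then have "(t + ?d) mod n = x - 1" using assms by (simp only: mod_add_self2) auto
  then have "x = vtx n (t + ?d)" using assms by (simp add: vtx_def)
  ultimately show ?thesis by blast
qed

section \<open>Hamiltonian cycles\<close>

text \<open>The neighbours are the successor and predecessor on the cycle. From four vertices on,
  positions two apart are not consecutive; this will exclude closing up to a triangle.\<close>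

lemma ham_cycle_neighbours:
  assumes "ham_cycle n C" "4 \<le> n" "v \<in> {1..n}"
  obtains x y where "x \<in> {1..n}" "y \<in> {1..n}" "x \<noteq> v" "y \<noteq> v" "x \<noteq> y"
    "{v, x} \<in> C" "{v, y} \<in> C" "{x, y} \<notin> C"
proof -
  obtain p where p: "distinct p" "set p = {1..n}" and C: "C = {{p ! i, p ! ((i + 1) mod n)} | i. i < n}"
    using assms(1) by (auto simp: ham_cycle_def)
  have len: "length p = n" using distinct_card[OF p(1)] p(2) by simp
  obtain i where i: "i < n" "v = p ! i" using assms(3) p(2) len by (metis in_set_conv_nth)
  define a where "a = (i + 1) mod n"
  define b where "b = (i + (n - 1)) mod n"
  have a: "a = (if i + 1 < n then i + 1 else 0)" using i assms(2) unfolding a_def by (subst mod_add_less_eq) auto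
  have b: "b = (if i = 0 then n - 1 else i - 1)"
    using i assms(2) unfolding b_def by (subst mod_add_less_eq) auto
  have ab: "a < n" "b < n" "a \<noteq> b" "a \<noteq> i" "b \<noteq> i"
    using i assms(2) unfolding a b by auto
  have bi: "(b + 1) mod n = i"
    using i assms(2) ab(2) b by (subst mod_add_less_eq) auto
  have eq: "p ! j = p ! k \<longleftrightarrow> j = k" if "j < n" "k < n" for j k
    using that p(1) len by (simp add: nth_eq_iff_index_eq)
  have in_p: "p ! j \<in> {1..n}" if "j < n" for j using that len p(2) by (metis nth_mem)
  have "{p ! a, p ! b} \<notin> C"
  proof
    assume "{p ! a, p ! b} \<in> C"
    then obtain j where j: "j < n" "{p ! a, p ! b} = {p ! j, p ! ((j + 1) mod n)}" by (auto simp: C)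
    have "(j + 1) mod n < n" using assms(2) by simp
    with j ab eq have "a = j \<and> b = (j + 1) mod n \<or> a = (j + 1) mod n \<and> b = j"
      by (auto simp: doubleton_eq_iff)
    moreover have "(j + 1) mod n = (if j + 1 < n then j + 1 else 0)"
      using j(1) assms(2) by (subst mod_add_less_eq) auto
    ultimately show False using a b i assms(2) by (auto split: if_splits)
  qed
  moreover have "{v, p ! a} \<in> C" using i by (auto simp: C a_def)
  moreover have "{v, p ! b} \<in> C" using ab(2) bi i unfolding C by (auto intro!: exI[of _ b] simp: insert_commute)
  ultimately show thesis
    using that[of "p ! a" "p ! b"] ab i in_p eq by simp
qed

lemma ham_cycle_edge:
  assumes "ham_cycle n C" "2 \<le> n" "e \<in> C"
  obtains x y where "x \<in> {1..n}" "y \<in> {1..n}" "x \<noteq> y" "e = {x, y}"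
proof -
  obtain p where p: "distinct p" "set p = {1..n}" and C: "C = {{p ! i, p ! ((i + 1) mod n)} | i. i < n}"
    using assms(1) by (auto simp: ham_cycle_def)
  have len: "length p = n" using distinct_card[OF p(1)] p(2) by simp
  obtain i where i: "i < n" "e = {p ! i, p ! ((i + 1) mod n)}" using assms(3) C by auto
  have "(i + 1) mod n < n" "(i + 1) mod n \<noteq> i" using i assms(2) by (auto simp: mod_if)
  then show thesis using that[OF _ _ _ i(2)] i len p by (metis nth_eq_iff_index_eq nth_mem)
qed

lemma standard_cycle_eq:
  assumes "2 \<le> n"
  shows "standard_cycle n = {{vtx n t, vtx n (t + 1)} | t. t < n}"
proof (intro equalityI subsetI)
  fix e assume "e \<in> standard_cycle n"
  then consider i where "e = {i, Suc i}" "1 \<le> i" "i < n" | "e = {1, n}"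
    by (auto simp: standard_cycle_def)
  then show "e \<in> {{vtx n t, vtx n (t + 1)} | t. t < n}"
  proof cases
    case 1
    then have "e = {vtx n (i - 1), vtx n (i - 1 + 1)}" by (simp add: vtx_def)
    then show ?thesis using 1 by (intro CollectI exI[of _ "i - 1"]) auto
  next
    case 2
    then have "e = {vtx n (n - 1), vtx n (n - 1 + 1)}" using assms by (auto simp: vtx_def)
    then show ?thesis using assms by (intro CollectI exI[of _ "n - 1"]) auto
  qed
next
  fix e assume "e \<in> {{vtx n t, vtx n (t + 1)} | t. t < n}"
  then obtain t where t: "t < n" "e = {vtx n t, vtx n (t + 1)}" by auto
  show "e \<in> standard_cycle n"
  proof (cases "t + 1 < n")
    case True
    then have "e = {t + 1, Suc (t + 1)}" using t by (simp add: vtx_def)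
    then show ?thesis using True unfolding standard_cycle_def by (intro UnI1 CollectI exI[of _ "t + 1"]) simp
  next
    case False
    then have "t + 1 = n" using t by simp
    then have "e = {1, n}" using t by (auto simp: vtx_def)
    then show ?thesis by (simp add: standard_cycle_def)
  qed
qed

lemma ham_cycle_standard_cycle:
  assumes "2 \<le> n" shows "ham_cycle n (standard_cycle n)"
  unfolding ham_cycle_def
proof (intro exI[of _ "[1..<Suc n]"] conjI)
  have "[1..<Suc n] ! (i mod n) = vtx n i" for i
    using assms by (simp add: vtx_def del: upt_Suc)
  then have "[1..<Suc n] ! i = vtx n i" if "i < n" for i using that by (metis mod_less)
  with \<open>\<And>i. [1..<Suc n] ! (i mod n) = vtx n i\<close>
  show "standard_cycle n = {{[1..<Suc n] ! i, [1..<Suc n] ! ((i + 1) mod n)} | i. i < n}"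
    unfolding standard_cycle_eq[OF assms] by (metis (no_types, lifting))
qed auto

lemma non_crossed_standard_cycle:
  assumes "e \<in> standard_cycle n" shows "non_crossed n D e"
  using assms unfolding non_crossed_def standard_cycle_def
  by (auto simp: crosses_def cross_ord_def edges_def doubleton_eq_iff)


theorem theorem21:
  fixes n :: nat and D :: "nat \<Rightarrow> nat \<Rightarrow> bool"
  assumes "odd n" and "n \<ge> 13" and "crossing_optimal n D"
  shows "{C. ham_cycle n C \<and> (\<forall>e \<in> C. non_crossed n D e)} = {standard_cycle n}"
proof -
  have n: "odd n" "9 \<le> n" "crossing_number n D = Z n"
    using assms by (auto simp: crossing_optimal_def)
  have "C = standard_cycle n" if C: "ham_cycle n C" and nc: "\<And>e. e \<in> C \<Longrightarrow> non_crossed n D e" for C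
  proof -
    \<comment> \<open>Steps of length 3 to \<open>n - 3\<close> are crossed; steps backwards by 1 or
      2 appear as \<open>n - 1\<close> and \<open>n - 2\<close>.\<close>
    have near: "d \<in> {1, 2, n - 2, n - 1}" if "{vtx n t, vtx n (t + d)} \<in> C" "d \<noteq> 0" "d < n" for t d
      using no_long_non_crossed[OF n _ _ nc[OF that(1)]] that(2,3) by fastforce
    have nbr: "\<exists>d e. d \<noteq> e \<and> d \<in> {1, 2, n - 2, n - 1} \<and> e \<in> {1, 2, n - 2, n - 1} \<and>
        {vtx n t, vtx n (t + d)} \<in> C \<and> {vtx n t, vtx n (t + e)} \<in> C \<and>
        {vtx n (t + d), vtx n (t + e)} \<notin> C" for t
    proof -
      have "vtx n t \<in> {1..n}" using n(2) by (simp add: vtx_def Suc_le_eq)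
      then obtain x y where xy: "x \<in> {1..n}" "y \<in> {1..n}" "x \<noteq> vtx n t" "y \<noteq> vtx n t" "x \<noteq> y"
        "{vtx n t, x} \<in> C" "{vtx n t, y} \<in> C" "{x, y} \<notin> C"
        using ham_cycle_neighbours[OF C] n(2) by auto
      obtain d e where de: "d < n" "x = vtx n (t + d)" "e < n" "y = vtx n (t + e)"
        using vtx_shift_surj[OF xy(1), of t] vtx_shift_surj[OF xy(2), of t] by blast
      have "d \<noteq> 0" "e \<noteq> 0" using xy(3,4) de by (metis add_0_right)+
      then have "d \<in> {1, 2, n - 2, n - 1}" "e \<in> {1, 2, n - 2, n - 1}"
        using near[OF xy(6)[unfolded de(2)]] near[OF xy(7)[unfolded de(4)]] de(1,3) by blast+
      moreover have "d \<noteq> e" using xy(5) de(2,4) by blast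
      ultimately show ?thesis using xy(6-8) unfolding de(2,4) by blast
    qed
    \<comment> \<open>Any further step of length 2 at \<open>t + 1\<close> would be consecutive to
      \<open>t (t + 2)\<close>. So the neighbours of \<open>t + 1\<close> would be \<open>t\<close>
      and \<open>t + 2\<close>, which are already joined in \<open>C\<close>.\<close>
    have no2: "{vtx n t, vtx n (t + 2)} \<notin> C" for t
    proof
      assume t: "{vtx n t, vtx n (t + 2)} \<in> C"
      have wrap: "t + 1 + (n - 1) = t + n" "t + 1 + (n - 2) = t + (n - 1)" using n(2) by auto
      obtain d e where de: "d \<noteq> e" "d \<in> {1, 2, n - 2, n - 1}" "e \<in> {1, 2, n - 2, n - 1}"
        "{vtx n (t + 1), vtx n (t + 1 + d)} \<in> C" "{vtx n (t + 1), vtx n (t + 1 + e)} \<in> C"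
        "{vtx n (t + 1 + d), vtx n (t + 1 + e)} \<notin> C"
        using nbr[of "t + 1"] by blast
      have "{vtx n (t + 1), vtx n (t + 1 + 2)} \<notin> C"
        using no_consecutive_short_non_crossed[OF n nc[OF t]] nc by (auto simp: eval_nat_numeral)
      \<comment> \<open>This is the edge from \<open>t + 1\<close> back to \<open>t - 1\<close>,
        whose successor in the consecutive pair is \<open>t (t + 2)\<close>.\<close>
      moreover have "{vtx n (t + 1), vtx n (t + 1 + (n - 2))} \<notin> C"
      proof
        assume "{vtx n (t + 1), vtx n (t + 1 + (n - 2))} \<in> C"
        moreover have "t + (n - 1) + 1 = t + n" "t + (n - 1) + 2 = t + 1 + n" "t + (n - 1) + 3 = t + 2 + n"
          using n(2) by auto
        ultimately have "non_crossed n D {vtx n (t + (n - 1)), vtx n (t + (n - 1) + 2)}"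
          "non_crossed n D {vtx n (t + (n - 1) + 1), vtx n (t + (n - 1) + 3)}"
          using nc t by (simp_all only: vtx_add wrap insert_commute)
        then show False by (rule no_consecutive_short_non_crossed[OF n])
      qed
      ultimately have "d \<in> {1, n - 1}" "e \<in> {1, n - 1}" using de by auto
      with de(1) have "{vtx n (t + 1 + d), vtx n (t + 1 + e)} = {vtx n (t + 1 + 1), vtx n (t + 1 + (n - 1))}"
        by auto
      also have "\<dots> = {vtx n t, vtx n (t + 2)}"
        unfolding wrap vtx_add by (simp add: insert_commute)
      finally show False using de(6) t by simp
    qed
    have near1: "d \<in> {1, n - 1}" if "{vtx n t, vtx n (t + d)} \<in> C" "d \<in> {1, 2, n - 2, n - 1}" for t d
    proof -
      have "t + (n - 2) + 2 = t + n" using n(2) by simp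
      then have "{vtx n t, vtx n (t + (n - 2))} = {vtx n (t + (n - 2)), vtx n (t + (n - 2) + 2)}"
        by (simp only: vtx_add insert_commute)
      then have "d \<noteq> n - 2" using that(1) no2[of "t + (n - 2)"] by auto
      moreover have "d \<noteq> 2" using that(1) no2 by auto
      ultimately show ?thesis using that(2) by blast
    qed
    have std: "standard_cycle n = {{vtx n t, vtx n (t + 1)} | t. t < n}"
      using standard_cycle_eq n(2) by simp
    have in_std: "{vtx n t, vtx n (t + 1)} \<in> standard_cycle n" for t
    proof -
      have "vtx n t = vtx n (t mod n)" "vtx n (t + 1) = vtx n (t mod n + 1)"
        by (simp_all add: vtx_def mod_Suc_eq)
      moreover have "t mod n < n" using n(2) by simp
      ultimately show ?thesis unfolding std by (intro CollectI exI[of _ "t mod n"] conjI) (simp_all only:)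
    qed
    show ?thesis
    proof (intro equalityI subsetI)
      fix e assume "e \<in> C"
      then obtain x y where xy: "x \<in> {1..n}" "y \<in> {1..n}" "x \<noteq> y" and e: "e = {x, y}"
        using ham_cycle_edge[OF C] n(2) by auto
      obtain t where t: "x = vtx n t" using vtx_shift_surj[OF xy(1), of 0] by auto
      obtain d where d: "d < n" "y = vtx n (t + d)" using vtx_shift_surj[OF xy(2), of t] by blast
      have "d \<noteq> 0" using xy(3) t d by (metis add_0_right)
      then have "d = 1 \<or> d = n - 1" using near near1 \<open>e \<in> C\<close> d unfolding e t by blast
      then show "e \<in> standard_cycle n"
      proof
        assume "d = n - 1"
        then have "t + d + 1 = t + n" using n(2) by simp
        then have "e = {vtx n (t + d), vtx n (t + d + 1)}"
          unfolding e t d(2) by (simp only: vtx_add insert_commute)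
        then show ?thesis using in_std by simp
      qed (use in_std e t d in simp)
    next
      fix e assume "e \<in> standard_cycle n"
      then obtain t where e: "e = {vtx n t, vtx n (t + 1)}" unfolding std by blast
      obtain d f where "d \<noteq> f" "d \<in> {1, 2, n - 2, n - 1}" "f \<in> {1, 2, n - 2, n - 1}"
        "{vtx n t, vtx n (t + d)} \<in> C" "{vtx n t, vtx n (t + f)} \<in> C"
        using nbr[of t] by blast
      moreover from this have "d \<in> {1, n - 1}" "f \<in> {1, n - 1}" using near1 by blast+
      \<comment> \<open>Two distinct steps chosen from \<open>1\<close> and \<open>n - 1\<close>
        include the forward one.\<close>
      ultimately have "d = 1 \<or> f = 1" by auto
      then show "e \<in> C"
        unfolding e using \<open>{vtx n t, vtx n (t + d)} \<in> C\<close> \<open>{vtx n t, vtx n (t + f)} \<in> C\<close> by (elim disjE) simp_all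
    qed
  qed
  moreover have "ham_cycle n (standard_cycle n)" using ham_cycle_standard_cycle n(2) by simp
  ultimately show ?thesis using non_crossed_standard_cycle by blast
qed

end
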